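(* Let $n\in\mathbb N$. For a given matrix $A\in M_n(\mathbb R)$ and a multi-index $\hat\alpha\in(0,1]^n$, the following statements are equivalent: (i) $\sigma_{\hat\alpha}(A)\subset\mathbb C_-$; (ii) there is a constant $h_0>0$ such that for all $\epsilon\in(0,h_0)$ and all $\epsilon$-rational approximations $\hat\beta\in(0,1]^n\cap\mathbb Q^n$ of $\hat\alpha$ associated with $A$, one has $\sigma_{\hat\beta}(A)\subset\mathbb C_-$ and $\delta^2_{\hat\beta}(A)\ge\epsilon$; (iii) there exists (for some $\epsilon>0$) an $\epsilon$-rational approximation $\hat\beta\in(0,1]^n\cap\mathbb Q^n$ of $\hat\alpha$ associated with $A$ such that $\sigma_{\hat\beta}(A)\subset\mathbb C_-$ and $\delta^2_{\hat\beta}(A)\ge\epsilon$.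
   Context: $M_n(\mathbb R)$ and $M_n(\mathbb C)$ are the sets of real and complex $n\times n$ matrices; $\mathbb C_-=\{z\in\mathbb C:\Re(z)<0\}$ and $\mathbb C_{\ge0}=\{z\in\mathbb C:\Re(z)\ge0\}$. Arguments are principal, $\arg(z)\in(-\pi,\pi]$, and for $\beta\in(0,1]$, $z^\beta=|z|^\beta\exp(\mathrm i\beta\arg(z))$ (principal branch, with $0^\beta=0$). For $\hat\gamma=(\gamma_1,\ldots,\gamma_n)\in(0,1]^n$ put $z^{\hat\gamma}I=\operatorname{diag}(z^{\gamma_1},\ldots,z^{\gamma_n})$. For $M\in M_n(\mathbb C)$, the $\hat\gamma$-order spectrum is $\sigma_{\hat\gamma}(M)=\{z\in\mathbb C:\det(z^{\hat\gamma}I-M)=0\}$. For $\epsilon>0$, the (Euclidean) $\hat\gamma$-order $\epsilon$-pseudospectrum of $A$ is $\sigma^2_{\hat\gamma,\epsilon}(A)=\{z\in\mathbb C:\|(z^{\hat\gamma}I-A)^{-1}\|_2^{-1}\le\epsilon\}$, where $\|\cdot\|_2$ is the matrix norm induced by the Euclidean norm and $\|M^{-1}\|_2^{-1}$ is taken to be $0$ when $\det M=0$. Moreover $$\delta^2_{\hat\gamma}(A)=\inf\{\|E\|_2:E\in M_n(\mathbb C),\ \sigma_{\hat\gamma}(A+E)\cap\mathbb C_{\ge0}\ne\emptyset\}$$ (the superscript $2$ refers to the norm $\|\cdot\|_2$; it is not a square). Definition. Given $A\in M_n(\mathbb R)$, $\hat\alpha=(\alpha_1,\ldots,\alpha_n)\in(0,1]^n$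 and $\epsilon>0$, a multi-index $\hat\beta=(\beta_1,\ldots,\beta_n)\in((0,1]\cap\mathbb Q)^n$ is an $\epsilon$-rational approximation of $\hat\alpha$ associated with $A$ if: (a) $0<\beta_i\le\alpha_i\le1$ for all $i\in\{1,\ldots,n\}$; (b) there exists a constant $R=R(A,\hat\alpha,\epsilon)\ge1$ such that $\sigma^2_{\hat\alpha,\epsilon}(A)\cap\{z\in\mathbb C:|z|>R\}=\sigma^2_{\hat\beta,\epsilon}(A)\cap\{z\in\mathbb C:|z|>R\}=\emptyset$; (c) there exists a constant $\rho=\rho(A,\hat\alpha,\epsilon)\in(0,1)$ such that $\sigma_{\hat\alpha}(A)\cap\{z\in\mathbb C:|z|<\rho\}=\sigma_{\hat\beta}(A)\cap\{z\in\mathbb C:|z|<\rho\}=\emptyset$; (d) for $R$ and $\rho$ chosen as in (b) and (c), $\sup_{\rho\le|z|\le R}|z^{\alpha_i}-z^{\beta_i}|<\epsilon$ for all $i\in\{1,\ldots,n\}$. (That is, there is a single pair $R,\rho$ for which (b), (c) and (d) hold.)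
   Formalization: For singular A no ε-rational approximations exist, so (ii) is vacuously true while (i) and (iii) fail; hence (ii) is taken with the added requirement that approximations exist for every ε in (0,h_0), and (ii) as worded is proved equivalent to (i) only when det A ≠ 0. *)

theory Defs
  imports "HOL-Analysis.Analysis"
begin

text \<open>
  A multi-index is a vector in \<^typ>\<open>real ^ 'n\<close>. The power \<open>z\<^sup>\<beta>\<close> is \<open>z powr of_real \<beta>\<close>,
  which is \<open>exp (\<beta> * Ln z)\<close> with the principal logarithm for \<open>z \<noteq> 0\<close>, and \<open>0\<close> for \<open>z = 0\<close>.
\<close>

definition pow_diag :: "complex \<Rightarrow> real ^ 'n \<Rightarrow> complex ^ 'n ^ 'n" where
  "pow_diag z \<gamma> = (\<chi> i j. if i = j then z powr of_real (\<gamma> $ i) else 0)"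

abbreviation cmat :: "real ^ 'n ^ 'n \<Rightarrow> complex ^ 'n ^ 'n" where
  "cmat A \<equiv> map_matrix of_real A"

text \<open>
  The norm of \<^typ>\<open>complex ^ 'n\<close> is the Euclidean one, so \<^const>\<open>onorm\<close> gives the spectral norm.
\<close>

definition norm2 :: "complex ^ 'n ^ 'n \<Rightarrow> real" where
  "norm2 M = onorm (\<lambda>x. M *v x)"

definition inv_norm2_inv :: "complex ^ 'n ^ 'n \<Rightarrow> real" where
  "inv_norm2_inv M = (if det M = 0 then 0 else inverse (norm2 (matrix_inv M)))"

definition spectrum :: "real ^ 'n \<Rightarrow> complex ^ 'n ^ 'n \<Rightarrow> complex set" where
  "spectrum \<gamma> M = {z. det (pow_diag z \<gamma> - M) = 0}"

definition pseudospectrum :: "real ^ 'n \<Rightarrow> real \<Rightarrow> complex ^ 'n ^ 'n \<Rightarrow> complex set" where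
  "pseudospectrum \<gamma> \<epsilon> M = {z. inv_norm2_inv (pow_diag z \<gamma> - M) \<le> \<epsilon>}"

text \<open>
  The set below is bounded below by \<open>0\<close> and nonempty (\<open>E = - M\<close> puts \<open>0\<close> into the spectrum),
  so \<^const>\<open>Inf\<close> on the reals is the true infimum.
\<close>

definition stab_dist :: "real ^ 'n \<Rightarrow> complex ^ 'n ^ 'n \<Rightarrow> real" where
  "stab_dist \<gamma> M = Inf {norm2 E | E. spectrum \<gamma> (M + E) \<inter> {z. 0 \<le> Re z} \<noteq> {}}"

definition rational_approx ::
  "real ^ 'n ^ 'n \<Rightarrow> real ^ 'n \<Rightarrow> real \<Rightarrow> real ^ 'n \<Rightarrow> bool" where
  "rational_approx A \<alpha> \<epsilon> \<beta> \<longleftrightarrow>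
     (\<forall>i. \<beta> $ i \<in> \<rat>) \<and>
     (\<forall>i. 0 < \<beta> $ i \<and> \<beta> $ i \<le> \<alpha> $ i \<and> \<alpha> $ i \<le> 1) \<and>
     (\<exists>R \<rho>. 1 \<le> R \<and> 0 < \<rho> \<and> \<rho> < 1 \<and>
        pseudospectrum \<alpha> \<epsilon> (cmat A) \<inter> {z. R < cmod z} = {} \<and>
        pseudospectrum \<beta> \<epsilon> (cmat A) \<inter> {z. R < cmod z} = {} \<and>
        spectrum \<alpha> (cmat A) \<inter> {z. cmod z < \<rho>} = {} \<and>
        spectrum \<beta> (cmat A) \<inter> {z. cmod z < \<rho>} = {} \<and>
        (\<forall>i. (SUP z\<in>{z. \<rho> \<le> cmod z \<and> cmod z \<le> R}.
                cmod (z powr of_real (\<alpha> $ i) - z powr of_real (\<beta> $ i))) < \<epsilon>))"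

end

theory Submission
  imports Defs
begin

text \<open>
  The number \<^const>\<open>inv_norm2_inv\<close> of \<open>M\<close> is the smallest singular value, the largest \<open>c\<close> with
  \<open>c * norm x \<le> norm (M *v x)\<close> for all \<open>x\<close>. Every spectral question is turned into one about such
  lower bounds, because they survive perturbations: changing \<open>M\<close> by a matrix of norm \<open>d\<close> costs at
  most \<open>d\<close>. Replacing the exponents \<open>\<alpha>\<close> by \<open>\<beta>\<close> at a point \<open>z\<close> is the perturbation by the diagonal
  matrix with entries \<open>z powr \<alpha>\<^sub>i - z powr \<beta>\<^sub>i\<close>, whose norm is the largest modulus of its entries.

  If the system with exponents \<open>\<beta>\<close> has distance at least \<open>\<epsilon>\<close> to instability, then the one with
  exponents \<open>\<alpha>\<close> is stable (\<open>stable_if_approx_stable\<close>): an \<open>\<alpha>\<close>-eigenvalue \<open>z\<close> with nonnegative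
  real part would lie in the annulus \<open>\<rho> \<le> cmod z \<le> R\<close>, where the diagonal perturbation has norm
  below \<open>\<epsilon>\<close>, and this perturbation makes \<open>z\<close> a \<open>\<beta>\<close>-eigenvalue.

  Conversely, if the system with exponents \<open>\<alpha>\<close> is stable, then compactness gives a lower bound
  \<open>m > 0\<close> for all its matrices at points of the closed right half-plane
  (\<open>stable_uniformly_bounded_below\<close>). A perturbation of norm below \<open>\<epsilon>\<close> that destabilises the
  system with exponents \<open>\<beta>\<close> at \<open>z\<close> would violate this bound if the powers of \<open>z\<close> differ by at most
  a fixed multiple of \<open>\<epsilon>\<close> and \<open>\<epsilon>\<close> is small. For \<open>1 < cmod z \<le> R\<close> they differ by less than \<open>\<epsilon>\<close> by
  the definition of the approximation. Near \<open>0\<close> that definition is silent, and it allows \<open>R\<close> and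
  \<open>\<rho>\<close> to vary with \<open>\<beta>\<close>; but the annulus always contains the unit circle, and there the closeness
  of the powers forces \<open>\<alpha>\<^sub>i - \<beta>\<^sub>i \<le> 4 * \<epsilon>\<close> (\<open>approx_exponents_close\<close>). This keeps the \<open>\<beta>\<^sub>i\<close> away from
  \<open>0\<close> and makes the powers uniformly close on the whole unit disc
  (\<open>cmod_powr_diff_le_unit_disc\<close>).

  Approximations exist for every \<open>\<epsilon> > 0\<close> as soon as \<open>A\<close> is nonsingular
  (\<open>exists_rational_approx\<close>), which stability implies because \<open>0\<close> is an eigenvalue of a singular
  system for every choice of the exponents.
\<close>

section \<open>Lower bounds for matrices and the spectral norm of the inverse\<close>

lemma norm_matrix_vector_le_norm2:
  fixes M :: "complex ^ 'n ^ 'n"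
  shows "norm (M *v x) \<le> norm2 M * norm x"
  unfolding norm2_def by (rule onorm) simp

lemma norm2_nonneg: "0 \<le> norm2 (M :: complex ^ 'n ^ 'n)"
  unfolding norm2_def by (rule onorm_pos_le) simp

lemma det_eq_0_iff_kernel:
  fixes M :: "complex ^ 'n ^ 'n"
  shows "det M = 0 \<longleftrightarrow> (\<exists>x. x \<noteq> 0 \<and> M *v x = 0)"
  using invertible_det_nz[of M] matrix_left_invertible_ker[of M]
  by (auto simp: invertible_left_inverse)

lemma pos_bounded_below_det_nz:
  fixes M :: "complex ^ 'n ^ 'n"
  assumes "0 < c" and below: "\<And>x. c * norm x \<le> norm (M *v x)"
  shows "det M \<noteq> 0"
proof
  assume "det M = 0"
  then obtain x where "x \<noteq> 0" "M *v x = 0" by (auto simp: det_eq_0_iff_kernel)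
  then have "c * norm x \<le> 0" using below[of x] by simp
  then show False using \<open>0 < c\<close> \<open>x \<noteq> 0\<close> by (simp add: mult_le_0_iff)
qed

lemma matrix_inv_mult_vector:
  fixes M :: "complex ^ 'n ^ 'n"
  assumes "det M \<noteq> 0"
  shows "matrix_inv M *v (M *v x) = x" and "M *v (matrix_inv M *v x) = x"
proof -
  have "invertible M" using assms by (simp add: invertible_det_nz)
  then have "matrix_inv M ** M = mat 1" "M ** matrix_inv M = mat 1"
    unfolding invertible_def matrix_inv_def by (metis (mono_tags, lifting) someI_ex)+
  then show "matrix_inv M *v (M *v x) = x" "M *v (matrix_inv M *v x) = x"
    by (simp_all add: matrix_vector_mul_assoc)
qed

text \<open>
  Together with \<open>inv_norm2_inv_le\<close>, this replaces the inverse matrix in the definition of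
  pseudospectra by estimates for \<open>norm (M *v x)\<close>.
\<close>

lemma le_inv_norm2_inv:
  fixes M :: "complex ^ 'n ^ 'n"
  assumes "0 < c" and below: "\<And>x. c * norm x \<le> norm (M *v x)"
  shows "c \<le> inv_norm2_inv M"
proof -
  have det: "det M \<noteq> 0"
    using pos_bounded_below_det_nz[OF assms] .
  have "norm (matrix_inv M *v y) \<le> inverse c * norm y" for y
    using below[of "matrix_inv M *v y"] \<open>0 < c\<close> matrix_inv_mult_vector(2)[OF det, of y]
    by (simp add: field_simps)
  then have le: "norm2 (matrix_inv M) \<le> inverse c"
    unfolding norm2_def by (rule onorm_le)
  have "(axis undefined 1 :: complex ^ 'n) \<noteq> 0" by (simp add: axis_eq_0_iff)
  then have "norm2 (matrix_inv M) \<noteq> 0"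
    using norm_matrix_vector_le_norm2[of "matrix_inv M" "M *v axis undefined 1"]
    by (auto simp: matrix_inv_mult_vector(1)[OF det])
  then have "0 < norm2 (matrix_inv M)" using norm2_nonneg[of "matrix_inv M"] by simp
  then show ?thesis
    using le \<open>0 < c\<close> le_imp_inverse_le[OF le] det by (simp add: inv_norm2_inv_def)
qed

lemma inv_norm2_inv_le:
  fixes M :: "complex ^ 'n ^ 'n"
  assumes "x \<noteq> 0" and above: "norm (M *v x) \<le> c * norm x"
  shows "inv_norm2_inv M \<le> c"
proof -
  have "0 \<le> c * norm x" using above norm_ge_zero[of "M *v x"] by linarith
  then have c: "0 \<le> c" using \<open>x \<noteq> 0\<close> by (simp add: zero_le_mult_iff)
  show ?thesis
  proof (cases "det M = 0")
    case True
    then show ?thesis using c by (simp add: inv_norm2_inv_def)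
  next
    case False
    have "norm x \<le> norm2 (matrix_inv M) * norm (M *v x)"
      using norm_matrix_vector_le_norm2[of "matrix_inv M" "M *v x"]
      by (simp add: matrix_inv_mult_vector(1)[OF False])
    also have "\<dots> \<le> norm2 (matrix_inv M) * (c * norm x)"
      by (intro mult_left_mono above norm2_nonneg)
    finally have "1 * norm x \<le> (norm2 (matrix_inv M) * c) * norm x" by (simp add: mult.assoc)
    then have 1: "1 \<le> norm2 (matrix_inv M) * c"
      using \<open>x \<noteq> 0\<close> by (simp add: mult_le_cancel_right)
    then have "norm2 (matrix_inv M) > 0"
      using norm2_nonneg[of "matrix_inv M"] by (cases "norm2 (matrix_inv M) = 0") auto
    then show ?thesis using 1 False by (simp add: inv_norm2_inv_def field_simps)
  qed
qed

section \<open>Diagonal matrices of powers\<close>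

lemma pow_diag_mult_vector: "pow_diag z \<gamma> *v x = (\<chi> i. z powr of_real (\<gamma> $ i) * x $ i)"
  by (simp add: pow_diag_def matrix_vector_mult_def vec_eq_iff if_distrib[of "\<lambda>a. a * _"]
      cong: if_cong)

lemma pow_diag_diff_upper:
  assumes "\<And>i. cmod (z powr of_real (\<alpha> $ i) - z powr of_real (\<beta> $ i)) \<le> c"
  shows "norm (pow_diag z \<alpha> *v x - pow_diag z \<beta> *v x) \<le> c * norm x"
proof -
  have "0 \<le> c" using assms[of undefined] norm_ge_zero order_trans by blast
  have "norm (pow_diag z \<alpha> *v x - pow_diag z \<beta> *v x) \<le> norm (c *\<^sub>R x)"
    using assms \<open>0 \<le> c\<close>
    by (intro norm_le_componentwise_cart)
      (simp add: pow_diag_mult_vector norm_mult mult_right_mono flip: left_diff_distrib)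
  then show ?thesis using \<open>0 \<le> c\<close> by simp
qed

lemma pow_diag_upper:
  assumes "\<And>i. cmod (z powr of_real (\<gamma> $ i)) \<le> c"
  shows "norm (pow_diag z \<gamma> *v x) \<le> c * norm x"
proof -
  have "0 \<le> c" using assms[of undefined] norm_ge_zero order_trans by blast
  have "norm (pow_diag z \<gamma> *v x) \<le> norm (c *\<^sub>R x)"
    using assms \<open>0 \<le> c\<close>
    by (intro norm_le_componentwise_cart) (simp add: pow_diag_mult_vector norm_mult mult_right_mono)
  then show ?thesis using \<open>0 \<le> c\<close> by simp
qed

lemma pow_diag_lower:
  assumes "0 \<le> c" "\<And>i. c \<le> cmod (z powr of_real (\<gamma> $ i))"
  shows "c * norm x \<le> norm (pow_diag z \<gamma> *v x)"
proof -
  have "norm (c *\<^sub>R x) \<le> norm (pow_diag z \<gamma> *v x)"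
    using assms
    by (intro norm_le_componentwise_cart) (simp add: pow_diag_mult_vector norm_mult mult_right_mono)
  then show ?thesis using \<open>0 \<le> c\<close> by simp
qed

lemma cmod_powr_of_real: "cmod (z powr of_real a) = cmod z powr a"
  by (simp add: norm_powr_real_powr')

text \<open>
  For \<open>cmod z \<ge> 1\<close> the modulus of \<open>z powr \<gamma>\<^sub>i\<close> increases with the exponent, so one bound serves
  all exponents above \<open>b\<close>: the diagonal part dominates \<open>M\<close> far away from \<open>0\<close>.
\<close>

lemma pow_diag_minus_lower_far:
  fixes M :: "complex ^ 'n ^ 'n"
  assumes "1 \<le> cmod z" "\<And>i. b \<le> \<gamma> $ i"
  shows "(cmod z powr b - norm2 M) * norm x \<le> norm ((pow_diag z \<gamma> - M) *v x)"
proof -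
  have "cmod z powr b * norm x \<le> norm (pow_diag z \<gamma> *v x)"
    by (rule pow_diag_lower) (use assms in \<open>auto simp: cmod_powr_of_real intro!: powr_mono\<close>)
  moreover note norm_matrix_vector_le_norm2[of M x]
    norm_triangle_ineq2[of "pow_diag z \<gamma> *v x" "M *v x"]
  ultimately show ?thesis
    by (simp add: matrix_vector_mult_diff_rdistrib left_diff_distrib)
qed

text \<open>
  For \<open>cmod z \<le> 1\<close> the monotonicity in the exponent is reversed, so the diagonal part is a
  perturbation of \<open>- M\<close> of norm at most \<open>cmod z powr b\<close>.
\<close>

lemma pow_diag_minus_lower_near:
  fixes M :: "complex ^ 'n ^ 'n"
  assumes "cmod z \<le> 1" "\<And>i. b \<le> \<gamma> $ i" and "\<And>x. s * norm x \<le> norm (M *v x)"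
  shows "(s - cmod z powr b) * norm x \<le> norm ((pow_diag z \<gamma> - M) *v x)"
proof -
  have "norm (pow_diag z \<gamma> *v x) \<le> cmod z powr b * norm x"
    by (rule pow_diag_upper) (use assms in \<open>auto simp: cmod_powr_of_real intro!: powr_mono'\<close>)
  moreover note assms(3)[of x] norm_triangle_ineq3[of "pow_diag z \<gamma> *v x" "M *v x"]
  ultimately show ?thesis
    by (simp add: matrix_vector_mult_diff_rdistrib left_diff_distrib)
qed

section \<open>Comparing powers with nearby exponents\<close>

text \<open>
  Mean value inequality on the half-plane bounded on the right by the vertical line through the
  rightmost of the two points: there the derivative of the exponential is at most its modulus on
  that line.
\<close>

lemma cmod_exp_diff_le:
  "cmod (exp u - exp v) \<le> max (exp (Re u)) (exp (Re v)) * cmod (u - v)"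
proof (rule field_differentiable_bound)
  show "convex {w. Re w \<le> max (Re u) (Re v)}" by (rule convex_halfspace_Re_le)
  show "cmod (exp w) \<le> max (exp (Re u)) (exp (Re v))" if "w \<in> {w. Re w \<le> max (Re u) (Re v)}" for w
    using that by (auto simp: le_max_iff_disj)
qed (auto intro!: derivative_eq_intros)

lemma cmod_powr_diff_le:
  assumes "z \<noteq> 0" "\<beta> \<le> \<alpha>"
  shows "cmod (z powr of_real \<alpha> - z powr of_real \<beta>)
    \<le> max (cmod z powr \<alpha>) (cmod z powr \<beta>) * ((\<alpha> - \<beta>) * (\<bar>ln (cmod z)\<bar> + pi))"
proof -
  have "cmod (Ln z) \<le> \<bar>ln (cmod z)\<bar> + pi"
    using cmod_le[of "Ln z"] assms Im_Ln_le_pi[of z] mpi_less_Im_Ln[of z] by auto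
  then have "(\<alpha> - \<beta>) * cmod (Ln z) \<le> (\<alpha> - \<beta>) * (\<bar>ln (cmod z)\<bar> + pi)"
    using assms by (intro mult_left_mono) auto
  moreover have "cmod (of_real \<alpha> * Ln z - of_real \<beta> * Ln z) = (\<alpha> - \<beta>) * cmod (Ln z)"
    using assms by (simp add: norm_mult flip: left_diff_distrib of_real_diff)
  ultimately show ?thesis
    using cmod_exp_diff_le[of "of_real \<alpha> * Ln z" "of_real \<beta> * Ln z"] assms
    by (simp add: powr_def) (meson exp_ge_zero le_max_iff_disj mult_left_mono order_trans)
qed

text \<open>
  The logarithm in \<open>cmod_powr_diff_le\<close> is unbounded at \<open>0\<close>, but the factor \<open>cmod z powr b\<close>
  compensates for it, since \<open>r powr b * \<bar>ln r\<bar> \<le> 1 / b\<close>. Hence the bound is uniform up to \<open>0\<close> as long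
  as the exponents stay away from \<open>0\<close>.
\<close>

lemma cmod_powr_diff_le_unit_disc:
  assumes "0 < b" "b \<le> \<beta>" "\<beta> \<le> \<alpha>" "cmod z \<le> 1"
  shows "cmod (z powr of_real \<alpha> - z powr of_real \<beta>) \<le> (1 / b + pi) * (\<alpha> - \<beta>)"
proof (cases "z = 0")
  case True
  then show ?thesis using assms by simp
next
  case False
  define r where "r = cmod z"
  have r: "0 < r" "r \<le> 1" using False assms by (auto simp: r_def)
  have "max (r powr \<alpha>) (r powr \<beta>) \<le> r powr b"
    using r assms by (simp add: powr_mono')
  then have 1: "max (r powr \<alpha>) (r powr \<beta>) * ((\<alpha> - \<beta>) * (\<bar>ln r\<bar> + pi))
      \<le> r powr b * ((\<alpha> - \<beta>) * (\<bar>ln r\<bar> + pi))"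
    using assms by (intro mult_right_mono) auto
  have "r powr b \<le> 1" using r assms by (simp add: powr_le1)
  have "b * - ln r \<le> exp (b * - ln r)" using exp_ge_add_one_self[of "b * - ln r"] by linarith
  also have "\<dots> = 1 / r powr b" using r by (simp add: powr_def exp_minus field_simps)
  finally have "r powr b * \<bar>ln r\<bar> \<le> 1 / b" using r assms by (simp add: field_simps)
  moreover have "r powr b * pi \<le> 1 * pi"
    using \<open>r powr b \<le> 1\<close> by (intro mult_right_mono) auto
  ultimately have "r powr b * (\<bar>ln r\<bar> + pi) \<le> 1 / b + pi" by (simp only: distrib_left mult_1)
  then have "r powr b * (\<bar>ln r\<bar> + pi) * (\<alpha> - \<beta>) \<le> (1 / b + pi) * (\<alpha> - \<beta>)"
    using assms by (intro mult_right_mono) auto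
  then show ?thesis
    using cmod_powr_diff_le[OF False \<open>\<beta> \<le> \<alpha>\<close>] 1 unfolding r_def[symmetric]
    by (simp add: mult_ac)
qed

text \<open>
  A single point of the unit circle suffices to recover the distance of the exponents. The point
  \<open>exp (\<i> / 2)\<close> is close enough to \<open>1\<close> for the quadratic error of the Taylor expansion
  \<open>exp (\<i> * d) \<approx> 1 + \<i> * d\<close> to cancel at most half of the linear term: here \<open>d\<close> is half the
  difference of the exponents, so \<open>d\<^sup>2 \<le> d / 2\<close>.
\<close>

lemma exponent_diff_le_powr_diff:
  assumes "0 \<le> \<beta>" "\<beta> \<le> \<alpha>" "\<alpha> \<le> 1"
  shows "\<alpha> - \<beta> \<le> 4 * cmod (exp (\<i> / 2) powr of_real \<alpha> - exp (\<i> / 2) powr of_real \<beta>)"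
proof -
  define d where "d = (\<alpha> - \<beta>) / 2"
  have d: "0 \<le> d" "d \<le> 1 / 2" using assms by (auto simp: d_def)
  have Ln: "Ln (exp (\<i> / 2)) = \<i> / 2" using pi_gt3 by (intro Ln_exp) auto
  have "of_real \<alpha> * (\<i> / 2) = of_real \<beta> * (\<i> / 2) + of_real d * \<i>"
    by (simp add: d_def field_simps)
  then have "exp (\<i> / 2) powr of_real \<alpha> - exp (\<i> / 2) powr of_real \<beta>
      = exp (of_real \<beta> * (\<i> / 2)) * (exp (of_real d * \<i>) - 1)"
    by (simp only: powr_def Ln right_diff_distrib exp_add mult_1_right) simp
  then have eq: "cmod (exp (\<i> / 2) powr of_real \<alpha> - exp (\<i> / 2) powr of_real \<beta>)
      = cmod (exp (of_real d * \<i>) - 1)"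
    by (simp add: norm_mult)
  have "cmod (exp (of_real d * \<i>) - (1 + of_real d * \<i>)) \<le> d ^ 2"
    using Taylor_exp[of "of_real d * \<i>" 1] d by (simp add: norm_mult power2_eq_square)
  moreover have "cmod (of_real d * \<i>) = d" using d by (simp add: norm_mult)
  moreover have "cmod (of_real d * \<i>) \<le> cmod (exp (of_real d * \<i>) - 1)
      + cmod (exp (of_real d * \<i>) - (1 + of_real d * \<i>))"
    using norm_triangle_ineq4[of "exp (of_real d * \<i>) - 1" "exp (of_real d * \<i>) - (1 + of_real d * \<i>)"]
    by simp
  moreover have "d ^ 2 \<le> d / 2" using d mult_left_mono[of d "1 / 2" d] by (simp add: power2_eq_square)
  ultimately have "2 * d \<le> 4 * cmod (exp (of_real d * \<i>) - 1)" by linarith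
  then show ?thesis unfolding eq by (simp add: d_def)
qed

section \<open>Distance to instability and rational approximations\<close>

lemma stab_dist_le:
  assumes "z \<in> spectrum \<gamma> (M + E)" "0 \<le> Re z"
  shows "stab_dist \<gamma> M \<le> norm2 E"
  unfolding stab_dist_def
proof (rule cInf_lower)
  have "spectrum \<gamma> (M + E) \<inter> {z. 0 \<le> Re z} \<noteq> {}" using assms by blast
  then show "norm2 E \<in> {norm2 E | E. spectrum \<gamma> (M + E) \<inter> {z. 0 \<le> Re z} \<noteq> {}}"
    by blast
next
  show "bdd_below {norm2 E | E. spectrum \<gamma> (M + E) \<inter> {z. 0 \<le> Re z} \<noteq> {}}"
    using norm2_nonneg by (intro bdd_belowI[of _ 0]) blast
qed

text \<open>
  The perturbation \<open>- M\<close>, which moves \<open>0\<close> into the spectrum, shows that the infimum is taken over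
  a nonempty set.
\<close>

lemma le_stab_dist:
  assumes "\<And>E z. z \<in> spectrum \<gamma> (M + E) \<Longrightarrow> 0 \<le> Re z \<Longrightarrow> c \<le> norm2 E"
  shows "c \<le> stab_dist \<gamma> M"
  unfolding stab_dist_def
proof (rule cInf_greatest)
  have "pow_diag 0 \<gamma> - (M + - M) = 0" by (simp add: pow_diag_def vec_eq_iff)
  then have "det (pow_diag 0 \<gamma> - (M + - M)) = 0"
    by (simp only: det_eq_0_iff_kernel) (auto intro!: exI[of _ "axis undefined 1"])
  then have "spectrum \<gamma> (M + - M) \<inter> {z. 0 \<le> Re z} \<noteq> {}"
    by (auto simp: spectrum_def intro!: exI[of _ 0])
  then show "{norm2 E | E. spectrum \<gamma> (M + E) \<inter> {z. 0 \<le> Re z} \<noteq> {}} \<noteq> {}"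
    by blast
qed (use assms in auto)

text \<open>
  The approximate eigenvector \<open>x\<close> is a kernel vector of the perturbed matrix.
\<close>

lemma spectrum_perturbed_approx_eigenvector:
  fixes M :: "complex ^ 'n ^ 'n"
  assumes "z \<in> spectrum \<gamma> (M + E)"
  obtains x where "x \<noteq> 0" "norm ((pow_diag z \<gamma> - M) *v x) \<le> norm2 E * norm x"
proof -
  obtain x where x: "x \<noteq> 0" "(pow_diag z \<gamma> - (M + E)) *v x = 0"
    using assms by (auto simp: spectrum_def det_eq_0_iff_kernel)
  then have "(pow_diag z \<gamma> - M) *v x = E *v x"
    by (simp add: matrix_vector_mult_diff_rdistrib matrix_vector_mult_add_rdistrib)
  then show ?thesis using that[of x] x(1) norm_matrix_vector_le_norm2[of E x] by simp
qed

text \<open>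
  On the reals a supremum bounds the individual values only if the set is bounded above; here the
  powers are bounded by those of \<open>R\<close>.
\<close>

lemma cmod_powr_diff_less_if_SUP_less:
  assumes "0 < \<alpha>" "0 < \<beta>" "1 \<le> R"
    and "(SUP z\<in>{z. \<rho> \<le> cmod z \<and> cmod z \<le> R}. cmod (z powr of_real \<alpha> - z powr of_real \<beta>)) < \<epsilon>"
    and "\<rho> \<le> cmod z" "cmod z \<le> R"
  shows "cmod (z powr of_real \<alpha> - z powr of_real \<beta>) < \<epsilon>"
proof -
  have "cmod (w powr of_real \<alpha> - w powr of_real \<beta>) \<le> R powr \<alpha> + R powr \<beta>"
    if "cmod w \<le> R" for w
    using norm_triangle_ineq4[of "w powr of_real \<alpha>" "w powr of_real \<beta>"] that assms
      powr_mono2[of \<alpha> "cmod w" R] powr_mono2[of \<beta> "cmod w" R]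
    by (simp add: cmod_powr_of_real)
  then have "bdd_above ((\<lambda>z. cmod (z powr of_real \<alpha> - z powr of_real \<beta>)) ` {z. \<rho> \<le> cmod z \<and> cmod z \<le> R})"
    by (intro bdd_aboveI2[where M = "R powr \<alpha> + R powr \<beta>"]) auto
  from cSUP_lessD[OF this assms(4), of z] show ?thesis using assms by simp
qed

text \<open>
  The form in which rational approximations are used: conditions on set intersections become
  bounds on the modulus, and the suprema become pointwise estimates.
\<close>

lemma rational_approxE:
  fixes A :: "real ^ 'n ^ 'n"
  assumes "rational_approx A \<alpha> \<epsilon> \<beta>"
  obtains R \<rho> where "1 \<le> R" "0 < \<rho>" "\<rho> < 1"
    and "\<And>z. z \<in> pseudospectrum \<alpha> \<epsilon> (cmat A) \<Longrightarrow> cmod z \<le> R"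
    and "\<And>z. z \<in> pseudospectrum \<beta> \<epsilon> (cmat A) \<Longrightarrow> cmod z \<le> R"
    and "\<And>z. z \<in> spectrum \<alpha> (cmat A) \<Longrightarrow> \<rho> \<le> cmod z"
    and "\<And>z i. \<rho> \<le> cmod z \<Longrightarrow> cmod z \<le> R \<Longrightarrow>
      cmod (z powr of_real (\<alpha> $ i) - z powr of_real (\<beta> $ i)) < \<epsilon>"
    and "\<And>i. 0 < \<beta> $ i \<and> \<beta> $ i \<le> \<alpha> $ i \<and> \<alpha> $ i \<le> 1"
proof -
  have exps: "0 < \<beta> $ i \<and> \<beta> $ i \<le> \<alpha> $ i \<and> \<alpha> $ i \<le> 1" for i
    using assms by (simp add: rational_approx_def)
  obtain R \<rho> where R: "1 \<le> R" "0 < \<rho>" "\<rho> < 1"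
      "pseudospectrum \<alpha> \<epsilon> (cmat A) \<inter> {z. R < cmod z} = {}"
      "pseudospectrum \<beta> \<epsilon> (cmat A) \<inter> {z. R < cmod z} = {}"
      "spectrum \<alpha> (cmat A) \<inter> {z. cmod z < \<rho>} = {}"
    and sup: "\<forall>i. (SUP z\<in>{z. \<rho> \<le> cmod z \<and> cmod z \<le> R}.
                cmod (z powr of_real (\<alpha> $ i) - z powr of_real (\<beta> $ i))) < \<epsilon>"
    using assms unfolding rational_approx_def by (elim conjE exE) (rule that)
  have "cmod (z powr of_real (\<alpha> $ i) - z powr of_real (\<beta> $ i)) < \<epsilon>"
    if "\<rho> \<le> cmod z" "cmod z \<le> R" for z i
    using that sup[rule_format, of i] exps[of i] R(1)
    by (intro cmod_powr_diff_less_if_SUP_less[of "\<alpha> $ i" "\<beta> $ i" R \<rho>]) auto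
  with R exps show ?thesis by (intro that[of R \<rho>]) (auto simp: disjoint_iff not_less)
qed

lemma exponents_pos_lower_bound:
  fixes \<alpha> :: "real ^ 'n"
  assumes "\<And>i. 0 < \<alpha> $ i"
  obtains a where "0 < a" "\<And>i. a \<le> \<alpha> $ i"
  by (rule that[of "Min (range (($) \<alpha>))"]) (use assms in auto)

section \<open>Existence of rational approximations\<close>

lemma nonsingular_bounded_below:
  fixes M :: "complex ^ 'n ^ 'n"
  assumes "det M \<noteq> 0"
  obtains s where "0 < s" "\<And>x. s * norm x \<le> norm (M *v x)"
proof -
  define B where "B = norm2 (matrix_inv M) + 1"
  have B: "0 < B" using norm2_nonneg[of "matrix_inv M"] by (simp add: B_def)
  have "norm x \<le> B * norm (M *v x)" for x
    using norm_matrix_vector_le_norm2[of "matrix_inv M" "M *v x"]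
    by (simp add: matrix_inv_mult_vector(1)[OF assms] B_def distrib_right add_increasing2)
  with B show ?thesis by (intro that[of "1 / B"]) (auto simp: field_simps)
qed

lemma det_cmat: "det (cmat A) = complex_of_real (det A)"
  by (simp add: det_def map_matrix_def)

text \<open>
  Both radii are chosen before \<open>\<beta>\<close>, and depend only on a common lower bound \<open>b\<close> for the exponents
  \<open>\<alpha>\<^sub>i\<close> and \<open>\<beta>\<^sub>i\<close>. On the resulting fixed annulus the powers depend on the exponents in a Lipschitz
  way, so rational \<open>\<beta>\<^sub>i\<close> slightly below \<open>\<alpha>\<^sub>i\<close> will do.
\<close>

lemma exists_rational_approx:
  fixes A :: "real ^ 'n ^ 'n"
  assumes \<alpha>: "\<And>i. 0 < \<alpha> $ i \<and> \<alpha> $ i \<le> 1" and "det A \<noteq> 0" "0 < \<epsilon>"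
  shows "\<exists>\<beta>. rational_approx A \<alpha> \<epsilon> \<beta>"
proof -
  obtain a where a: "0 < a" "\<And>i. a \<le> \<alpha> $ i"
    using exponents_pos_lower_bound \<alpha> by metis
  define b where "b = a / 2"
  have b: "0 < b" using a by (simp add: b_def)
  obtain s where s: "0 < s" "\<And>x. s * norm x \<le> norm (cmat A *v x)"
    using nonsingular_bounded_below[of "cmat A"] \<open>det A \<noteq> 0\<close> by (auto simp: det_cmat)
  \<comment> \<open>Beyond \<open>R\<close> the diagonal part exceeds the norm of \<open>A\<close> by \<open>2 * \<epsilon>\<close>, a margin that excludes the
    boundary case of the pseudospectrum; below \<open>\<rho>\<close> it is smaller than the lower bound \<open>s\<close> of \<open>A\<close>.\<close>
  define R where "R = max 1 ((norm2 (cmat A) + 2 * \<epsilon>) powr (1 / b))"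
  define \<rho> where "\<rho> = min (1 / 2) (s powr (1 / b))"
  have R: "1 \<le> R" and \<rho>: "0 < \<rho>" "\<rho> < 1" using s by (auto simp: R_def \<rho>_def)
  \<comment> \<open>\<open>L\<close> bounds the logarithm, and \<open>R\<close> the powers, on the annulus.\<close>
  define L where "L = ln R - ln \<rho> + pi"
  have L: "0 < L" using R \<rho> pi_gt_zero by (auto simp: L_def intro!: add_nonneg_pos order_trans[of "ln \<rho>" 0])
  define \<delta> where "\<delta> = \<epsilon> / (2 * R * L)"
  have \<delta>: "0 < \<delta>" using L R \<open>0 < \<epsilon>\<close> by (simp add: \<delta>_def)
  have "\<exists>q\<in>\<rat>. max b (\<alpha> $ i - \<delta>) < q \<and> q < \<alpha> $ i" for i
    using Rats_dense_in_real[of "max b (\<alpha> $ i - \<delta>)" "\<alpha> $ i"] \<delta> a(1) a(2)[of i] by (auto simp: b_def)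
  then obtain q where q: "\<And>i. q i \<in> \<rat> \<and> max b (\<alpha> $ i - \<delta>) < q i \<and> q i < \<alpha> $ i" by metis
  define \<beta> :: "real ^ 'n" where "\<beta> = (\<chi> i. q i)"
  have \<beta>: "\<beta> $ i \<in> \<rat>" "b < \<beta> $ i" "\<alpha> $ i - \<beta> $ i < \<delta>" "\<beta> $ i < \<alpha> $ i" for i
    using q[of i] by (auto simp: \<beta>_def)
  have \<alpha>b: "b \<le> \<alpha> $ i" and \<beta>b: "b \<le> \<beta> $ i" for i using \<beta>[of i] by auto
  have far: "pseudospectrum \<gamma> \<epsilon> (cmat A) \<inter> {z. R < cmod z} = {}" if "\<And>i. b \<le> \<gamma> $ i" for \<gamma>
  proof -
    have "\<epsilon> < inv_norm2_inv (pow_diag z \<gamma> - cmat A)" if z: "R < cmod z" for z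
    proof -
      have "norm2 (cmat A) + 2 * \<epsilon> = ((norm2 (cmat A) + 2 * \<epsilon>) powr (1 / b)) powr b"
        using b \<open>0 < \<epsilon>\<close> norm2_nonneg[of "cmat A"] by (simp add: powr_powr)
      also have "\<dots> \<le> cmod z powr b" using z b by (intro powr_mono2) (auto simp: R_def)
      finally have "2 * \<epsilon> \<le> cmod z powr b - norm2 (cmat A)" by simp
      then have "2 * \<epsilon> * norm x \<le> norm ((pow_diag z \<gamma> - cmat A) *v x)" for x
        using pow_diag_minus_lower_far[of z b \<gamma> "cmat A" x] \<open>\<And>i. b \<le> \<gamma> $ i\<close> z R
        by (smt (verit) mult_right_mono norm_ge_zero)
      then have "2 * \<epsilon> \<le> inv_norm2_inv (pow_diag z \<gamma> - cmat A)"
        using \<open>0 < \<epsilon>\<close> by (intro le_inv_norm2_inv) auto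
      then show ?thesis using \<open>0 < \<epsilon>\<close> by simp
    qed
    then show ?thesis by (fastforce simp: pseudospectrum_def)
  qed
  have near: "spectrum \<gamma> (cmat A) \<inter> {z. cmod z < \<rho>} = {}" if "\<And>i. b \<le> \<gamma> $ i" for \<gamma>
  proof -
    have "det (pow_diag z \<gamma> - cmat A) \<noteq> 0" if z: "cmod z < \<rho>" for z
    proof -
      have "cmod z powr b < (s powr (1 / b)) powr b"
        using z b by (intro powr_less_mono2) (auto simp: \<rho>_def)
      also have "\<dots> = s" using b s by (simp add: powr_powr)
      finally have pos: "0 < s - cmod z powr b" by simp
      have "(s - cmod z powr b) * norm x \<le> norm ((pow_diag z \<gamma> - cmat A) *v x)" for x
        using z \<rho> \<open>\<And>i. b \<le> \<gamma> $ i\<close> s by (intro pow_diag_minus_lower_near) auto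
      with pos show ?thesis by (rule pos_bounded_below_det_nz)
    qed
    then show ?thesis by (auto simp: spectrum_def)
  qed
  have close: "cmod (z powr of_real (\<alpha> $ i) - z powr of_real (\<beta> $ i)) \<le> \<epsilon> / 2"
    if z: "\<rho> \<le> cmod z" "cmod z \<le> R" for z i
  proof -
    have z0: "0 < cmod z" using z(1) \<rho>(1) by linarith
    have "cmod z powr \<gamma> \<le> R" if "0 < \<gamma>" "\<gamma> \<le> 1" for \<gamma>
      using powr_mono2[of \<gamma> "cmod z" R] powr_mono[of \<gamma> 1 R] that z R by simp
    then have "max (cmod z powr (\<alpha> $ i)) (cmod z powr (\<beta> $ i)) \<le> R"
      using \<alpha>[of i] \<beta>[of i] b by simp
    moreover have "\<bar>ln (cmod z)\<bar> + pi \<le> L"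
    proof -
      have "ln \<rho> \<le> ln (cmod z)" "ln (cmod z) \<le> ln R" "0 \<le> ln R" "ln \<rho> \<le> 0"
        using z z0 \<rho> R by (simp_all del: zero_less_norm_iff)
      then show ?thesis by (simp add: L_def)
    qed
    ultimately have "max (cmod z powr (\<alpha> $ i)) (cmod z powr (\<beta> $ i)) *
        ((\<alpha> $ i - \<beta> $ i) * (\<bar>ln (cmod z)\<bar> + pi)) \<le> R * (\<delta> * L)"
      using R L \<delta> \<beta>[of i] by (intro mult_mono mult_nonneg_nonneg) auto
    also have "\<dots> = \<epsilon> / 2" using R L by (simp add: \<delta>_def)
    finally show ?thesis
      using cmod_powr_diff_le[of z "\<beta> $ i" "\<alpha> $ i"] z0 \<beta>[of i] by fastforce
  qed
  have "(SUP z\<in>{z. \<rho> \<le> cmod z \<and> cmod z \<le> R}.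
      cmod (z powr of_real (\<alpha> $ i) - z powr of_real (\<beta> $ i))) < \<epsilon>" for i
  proof -
    have "(1 :: complex) \<in> {z. \<rho> \<le> cmod z \<and> cmod z \<le> R}" using \<rho> R by simp
    then have "(SUP z\<in>{z. \<rho> \<le> cmod z \<and> cmod z \<le> R}.
        cmod (z powr of_real (\<alpha> $ i) - z powr of_real (\<beta> $ i))) \<le> \<epsilon> / 2"
      using close by (intro cSUP_least) blast+
    then show ?thesis using \<open>0 < \<epsilon>\<close> by simp
  qed
  moreover have "0 < \<beta> $ i \<and> \<beta> $ i \<le> \<alpha> $ i \<and> \<alpha> $ i \<le> 1" for i
    using \<beta>[of i] b \<alpha>[of i] by auto
  ultimately have "rational_approx A \<alpha> \<epsilon> \<beta>"
    unfolding rational_approx_def using R \<rho> far[OF \<alpha>b] far[OF \<beta>b] near[OF \<alpha>b] near[OF \<beta>b] \<beta>(1)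
    by blast
  then show ?thesis ..
qed

section \<open>Stability transfers between the exponents\<close>

text \<open>
  The perturbation \<open>E\<close> that exchanges the powers at an unstable \<open>\<alpha>\<close>-eigenvalue \<open>z\<close> satisfies
  \<open>pow_diag z \<beta> - (A + E) = pow_diag z \<alpha> - A\<close>, so it destabilises the system with exponents \<open>\<beta>\<close>.
\<close>

lemma stable_if_approx_stable:
  fixes A :: "real ^ 'n ^ 'n"
  assumes "rational_approx A \<alpha> \<epsilon> \<beta>" "0 < \<epsilon>" "\<epsilon> \<le> stab_dist \<beta> (cmat A)"
  shows "spectrum \<alpha> (cmat A) \<subseteq> {z. Re z < 0}"
proof (rule ccontr)
  assume "\<not> ?thesis"
  then obtain z where z: "z \<in> spectrum \<alpha> (cmat A)" "0 \<le> Re z" by (force simp: not_less)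
  obtain R \<rho> where R: "\<And>z. z \<in> pseudospectrum \<alpha> \<epsilon> (cmat A) \<Longrightarrow> cmod z \<le> R"
    and \<rho>: "\<And>z. z \<in> spectrum \<alpha> (cmat A) \<Longrightarrow> \<rho> \<le> cmod z"
    and close: "\<And>z i. \<rho> \<le> cmod z \<Longrightarrow> cmod z \<le> R \<Longrightarrow>
      cmod (z powr of_real (\<alpha> $ i) - z powr of_real (\<beta> $ i)) < \<epsilon>"
    using assms(1) by (rule rational_approxE) (rule that)
  have "z \<in> pseudospectrum \<alpha> \<epsilon> (cmat A)"
    using z \<open>0 < \<epsilon>\<close> by (simp add: spectrum_def pseudospectrum_def inv_norm2_inv_def)
  then have close_z: "cmod (z powr of_real (\<alpha> $ i) - z powr of_real (\<beta> $ i)) < \<epsilon>" for i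
    using R \<rho>[OF z(1)] close by simp
  define c where "c = Max (range (\<lambda>i. cmod (z powr of_real (\<alpha> $ i) - z powr of_real (\<beta> $ i))))"
  have "c < \<epsilon>" unfolding c_def using close_z by (subst Max_less_iff) auto
  define E where "E = pow_diag z \<beta> - pow_diag z \<alpha>"
  have "norm (E *v x) \<le> c * norm x" for x
  proof -
    have "norm (pow_diag z \<alpha> *v x - pow_diag z \<beta> *v x) \<le> c * norm x"
      by (rule pow_diag_diff_upper) (simp add: c_def)
    then show ?thesis by (simp add: E_def matrix_vector_mult_diff_rdistrib norm_minus_commute)
  qed
  then have "norm2 E \<le> c" unfolding norm2_def by (rule onorm_le)
  moreover have "z \<in> spectrum \<beta> (cmat A + E)" using z by (simp add: spectrum_def E_def)
  then have "stab_dist \<beta> (cmat A) \<le> norm2 E" using z by (intro stab_dist_le)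
  ultimately show False using \<open>c < \<epsilon>\<close> assms by linarith
qed

text \<open>
  Outside a large disc the diagonal part dominates. In the half-disc, the bound is a minimum over
  \<open>z\<close> and over unit vectors \<open>x\<close>; it exists because principal powers with positive exponent are
  continuous on the closed right half-plane, including \<open>0\<close>, and it is positive by stability.
\<close>

lemma stable_uniformly_bounded_below:
  fixes M :: "complex ^ 'n ^ 'n"
  assumes \<alpha>: "\<And>i. 0 < \<alpha> $ i" and stable: "spectrum \<alpha> M \<subseteq> {z. Re z < 0}"
  obtains m where "0 < m"
    "\<And>z x. 0 \<le> Re z \<Longrightarrow> m * norm x \<le> norm ((pow_diag z \<alpha> - M) *v x)"
proof -
  obtain a where a: "0 < a" "\<And>i. a \<le> \<alpha> $ i" using exponents_pos_lower_bound \<alpha> by metis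
  define R where "R = max 1 ((norm2 M + 1) powr (1 / a))"
  define K :: "(complex \<times> (complex ^ 'n)) set"
    where "K = (cball 0 R \<inter> {z. 0 \<le> Re z}) \<times> sphere 0 1"
  have "compact K"
    unfolding K_def
    by (intro compact_Times compact_Int_closed closed_halfspace_Re_ge) auto
  moreover have "(0, axis undefined 1) \<in> K" by (simp add: K_def R_def)
  then have "K \<noteq> {}" by blast
  moreover have "continuous_on K (\<lambda>(z, x). norm ((pow_diag z \<alpha> - M) *v x))"
  proof -
    have "continuous_on K (\<lambda>p. fst p powr of_real (\<alpha> $ i))" for i
      using \<alpha>[of i] by (intro continuous_on_powr_complex continuous_intros) (auto simp: K_def)
    note cont = this
    have "continuous_on K (\<lambda>p. norm ((\<chi> i. fst p powr of_real (\<alpha> $ i) * snd p $ i)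
        - (\<chi> i. \<Sum>j\<in>UNIV. M $ i $ j * snd p $ j)))"
      by (intro continuous_on_norm continuous_on_diff continuous_on_vec_lambda continuous_on_sum
          continuous_on_mult cont continuous_intros)
    then show ?thesis
      by (simp add: case_prod_unfold matrix_vector_mult_diff_rdistrib pow_diag_mult_vector
          matrix_vector_mult_def[of M])
  qed
  ultimately obtain p where p: "p \<in> K"
    "\<And>q. q \<in> K \<Longrightarrow> norm ((pow_diag (fst p) \<alpha> - M) *v snd p) \<le> norm ((pow_diag (fst q) \<alpha> - M) *v snd q)"
    using continuous_attains_inf[of K] by (metis (mono_tags, lifting) case_prod_unfold)
  define \<mu> where "\<mu> = norm ((pow_diag (fst p) \<alpha> - M) *v snd p)"
  have "0 \<le> Re (fst p)" "snd p \<noteq> 0" using p(1) by (auto simp: K_def)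
  then have "det (pow_diag (fst p) \<alpha> - M) \<noteq> 0" using stable by (force simp: spectrum_def)
  then have "0 < \<mu>" using \<open>snd p \<noteq> 0\<close> by (auto simp: \<mu>_def det_eq_0_iff_kernel)
  have "min 1 \<mu> * norm x \<le> norm ((pow_diag z \<alpha> - M) *v x)" if z: "0 \<le> Re z" for z x
  proof (cases "cmod z \<le> R")
    case True
    show ?thesis
    proof (cases "x = 0")
      case False
      define y where "y = (1 / norm x) *\<^sub>R x"
      have "(z, y) \<in> K" using z True False by (simp add: K_def y_def)
      then have "\<mu> \<le> norm ((pow_diag z \<alpha> - M) *v y)" using p(2)[of "(z, y)"] by (simp add: \<mu>_def)
      also have "\<dots> = norm ((pow_diag z \<alpha> - M) *v x) / norm x"
        by (simp add: y_def linear_scale[OF matrix_vector_mul_linear])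
      finally have "\<mu> * norm x \<le> norm ((pow_diag z \<alpha> - M) *v x)"
        using False by (simp add: field_simps)
      then show ?thesis
        by (meson min.cobounded2 mult_right_mono norm_ge_zero order_trans)
    qed simp
  next
    case False
    have "norm2 M + 1 = ((norm2 M + 1) powr (1 / a)) powr a"
      using a norm2_nonneg[of M] by (simp add: powr_powr)
    also have "\<dots> \<le> cmod z powr a" using False a by (intro powr_mono2) (auto simp: R_def)
    finally have "min 1 \<mu> * norm x \<le> (cmod z powr a - norm2 M) * norm x"
      by (intro mult_right_mono) auto
    also have "\<dots> \<le> norm ((pow_diag z \<alpha> - M) *v x)"
      using False a by (intro pow_diag_minus_lower_far) (auto simp: R_def)
    finally show ?thesis .
  qed
  then show ?thesis using \<open>0 < \<mu>\<close> by (intro that[of "min 1 \<mu>"]) auto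
qed

text \<open>
  The radii of an approximation satisfy \<open>\<rho> < 1 \<le> R\<close>, so the closeness condition covers the unit
  circle whatever the radii are.
\<close>

lemma approx_exponents_close:
  assumes "rational_approx A \<alpha> \<epsilon> \<beta>"
  shows "\<alpha> $ i - \<beta> $ i \<le> 4 * \<epsilon>"
proof -
  obtain R \<rho> where R: "1 \<le> R" "\<rho> < 1"
    and close: "\<And>z i. \<rho> \<le> cmod z \<Longrightarrow> cmod z \<le> R \<Longrightarrow>
      cmod (z powr of_real (\<alpha> $ i) - z powr of_real (\<beta> $ i)) < \<epsilon>"
    and exps: "\<And>i. 0 < \<beta> $ i \<and> \<beta> $ i \<le> \<alpha> $ i \<and> \<alpha> $ i \<le> 1"
    using assms(1) by (rule rational_approxE) (rule that)
  have "cmod (exp (\<i> / 2) powr of_real (\<alpha> $ i) - exp (\<i> / 2) powr of_real (\<beta> $ i)) < \<epsilon>"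
    using R by (intro close) auto
  then show ?thesis
    using exponent_diff_le_powr_diff[of "\<beta> $ i" "\<alpha> $ i"] exps[of i] by linarith
qed

text \<open>
  For \<open>\<epsilon> < h\<close> the exponents \<open>\<beta>\<^sub>i\<close> stay above \<open>a / 2\<close>, and the passage from \<open>\<beta>\<close> to \<open>\<alpha>\<close> costs at most
  \<open>k * \<epsilon>\<close> at every relevant \<open>z\<close>. Together with a destabilising perturbation of norm below \<open>\<epsilon>\<close> this
  stays below \<open>(1 + k) * \<epsilon> < m\<close>, against the uniform lower bound \<open>m\<close>.
\<close>

lemma approx_stable_if_stable:
  fixes A :: "real ^ 'n ^ 'n"
  assumes \<alpha>: "\<And>i. 0 < \<alpha> $ i" and stable: "spectrum \<alpha> (cmat A) \<subseteq> {z. Re z < 0}"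
  obtains h where "0 < h"
    "\<And>\<epsilon> \<beta>. 0 < \<epsilon> \<Longrightarrow> \<epsilon> < h \<Longrightarrow> rational_approx A \<alpha> \<epsilon> \<beta> \<Longrightarrow>
      spectrum \<beta> (cmat A) \<subseteq> {z. Re z < 0} \<and> \<epsilon> \<le> stab_dist \<beta> (cmat A)"
proof -
  obtain a where a: "0 < a" "\<And>i. a \<le> \<alpha> $ i" using exponents_pos_lower_bound \<alpha> by metis
  obtain m where m: "0 < m"
    "\<And>z x. 0 \<le> Re z \<Longrightarrow> m * norm x \<le> norm ((pow_diag z \<alpha> - cmat A) *v x)"
    using stable_uniformly_bounded_below[OF \<alpha> stable] by metis
  define k where "k = 1 + 4 * (2 / a + pi)"
  have k: "1 \<le> k" using a by (simp add: k_def)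
  define h where "h = min (a / 8) (m / (1 + k))"
  have "0 < h" using a m k by (simp add: h_def)
  moreover have "spectrum \<beta> (cmat A) \<subseteq> {z. Re z < 0} \<and> \<epsilon> \<le> stab_dist \<beta> (cmat A)"
    if \<epsilon>: "0 < \<epsilon>" "\<epsilon> < h" and approx: "rational_approx A \<alpha> \<epsilon> \<beta>" for \<epsilon> \<beta>
  proof -
    obtain R \<rho> where R: "\<rho> < 1" "\<And>z. z \<in> pseudospectrum \<beta> \<epsilon> (cmat A) \<Longrightarrow> cmod z \<le> R"
      and close: "\<And>z i. \<rho> \<le> cmod z \<Longrightarrow> cmod z \<le> R \<Longrightarrow>
        cmod (z powr of_real (\<alpha> $ i) - z powr of_real (\<beta> $ i)) < \<epsilon>"
      and exps: "\<And>i. 0 < \<beta> $ i \<and> \<beta> $ i \<le> \<alpha> $ i \<and> \<alpha> $ i \<le> 1"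
      using approx by (rule rational_approxE) (rule that)
    have b: "a / 2 \<le> \<beta> $ i" for i
      using approx_exponents_close[OF approx, of i] \<epsilon> a(2)[of i] by (simp add: h_def)
    have robust: "\<epsilon> \<le> norm2 E" if z: "z \<in> spectrum \<beta> (cmat A + E)" "0 \<le> Re z" for E z
    proof (rule ccontr)
      assume "\<not> \<epsilon> \<le> norm2 E"
      obtain x where x: "x \<noteq> 0" "norm ((pow_diag z \<beta> - cmat A) *v x) \<le> norm2 E * norm x"
        using spectrum_perturbed_approx_eigenvector z by metis
      have "inv_norm2_inv (pow_diag z \<beta> - cmat A) \<le> norm2 E" using x by (rule inv_norm2_inv_le)
      then have "z \<in> pseudospectrum \<beta> \<epsilon> (cmat A)"
        using \<open>\<not> \<epsilon> \<le> norm2 E\<close> by (simp add: pseudospectrum_def)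
      then have zR: "cmod z \<le> R" using R by blast
      have "cmod (z powr of_real (\<alpha> $ i) - z powr of_real (\<beta> $ i)) \<le> k * \<epsilon>" for i
      proof (cases "cmod z \<le> 1")
        case True
        have "cmod (z powr of_real (\<alpha> $ i) - z powr of_real (\<beta> $ i))
            \<le> (1 / (a / 2) + pi) * (\<alpha> $ i - \<beta> $ i)"
          using a b True exps by (intro cmod_powr_diff_le_unit_disc) auto
        also have "\<dots> \<le> (1 / (a / 2) + pi) * (4 * \<epsilon>)"
          using approx_exponents_close[OF approx, of i] a by (intro mult_left_mono) auto
        also have "\<dots> \<le> k * \<epsilon>" using \<epsilon> by (simp add: k_def algebra_simps)
        finally show ?thesis .
      next
        case False
        then have "cmod (z powr of_real (\<alpha> $ i) - z powr of_real (\<beta> $ i)) < \<epsilon>"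
          using R zR by (intro close) auto
        also have "\<epsilon> \<le> k * \<epsilon>" using k \<epsilon> by simp
        finally show ?thesis by simp
      qed
      then have "norm (pow_diag z \<alpha> *v x - pow_diag z \<beta> *v x) \<le> k * \<epsilon> * norm x"
        by (rule pow_diag_diff_upper)
      moreover have "(pow_diag z \<alpha> - cmat A) *v x
          = (pow_diag z \<beta> - cmat A) *v x + (pow_diag z \<alpha> *v x - pow_diag z \<beta> *v x)"
        by (simp add: matrix_vector_mult_diff_rdistrib)
      ultimately have "norm ((pow_diag z \<alpha> - cmat A) *v x) \<le> norm2 E * norm x + k * \<epsilon> * norm x"
        using x norm_triangle_mono by metis
      with m(2)[OF z(2), of x] have "m * norm x \<le> (norm2 E + k * \<epsilon>) * norm x"
        by (simp add: distrib_right)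
      then have "m \<le> norm2 E + k * \<epsilon>" using x by (simp add: mult_le_cancel_right)
      also have "\<dots> < (1 + k) * \<epsilon>" using \<open>\<not> \<epsilon> \<le> norm2 E\<close> by (simp add: distrib_right)
      also have "\<dots> < m" using \<epsilon> k by (simp add: h_def field_simps)
      finally show False .
    qed
    have "norm2 (0 :: complex ^ 'n ^ 'n) = 0" by (simp add: norm2_def onorm_zero)
    then have "spectrum \<beta> (cmat A) \<subseteq> {z. Re z < 0}"
      using robust[of _ 0] \<epsilon> by (force simp: not_le intro: ccontr)
    then show ?thesis using le_stab_dist robust by blast
  qed
  ultimately show ?thesis using that by blast
qed

theorem theorem4p6:
  fixes A :: "real ^ 'n ^ 'n" and \<alpha> :: "real ^ 'n"
  assumes "\<And>i. 0 < \<alpha> $ i \<and> \<alpha> $ i \<le> 1"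
  shows
    "(spectrum \<alpha> (cmat A) \<subseteq> {z. Re z < 0} \<longleftrightarrow>
        (\<exists>h0>0. \<forall>\<epsilon>. 0 < \<epsilon> \<and> \<epsilon> < h0 \<longrightarrow>
           (\<exists>\<beta>. rational_approx A \<alpha> \<epsilon> \<beta>) \<and>
           (\<forall>\<beta>. rational_approx A \<alpha> \<epsilon> \<beta> \<longrightarrow>
              spectrum \<beta> (cmat A) \<subseteq> {z. Re z < 0} \<and> \<epsilon> \<le> stab_dist \<beta> (cmat A)))) \<and>
     (spectrum \<alpha> (cmat A) \<subseteq> {z. Re z < 0} \<longleftrightarrow>
        (\<exists>\<epsilon>>0. \<exists>\<beta>. rational_approx A \<alpha> \<epsilon> \<beta> \<and>
           spectrum \<beta> (cmat A) \<subseteq> {z. Re z < 0} \<and> \<epsilon> \<le> stab_dist \<beta> (cmat A))) \<and>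
     (det A \<noteq> 0 \<longrightarrow>
        (spectrum \<alpha> (cmat A) \<subseteq> {z. Re z < 0} \<longleftrightarrow>
           (\<exists>h0>0. \<forall>\<epsilon>. 0 < \<epsilon> \<and> \<epsilon> < h0 \<longrightarrow>
              (\<forall>\<beta>. rational_approx A \<alpha> \<epsilon> \<beta> \<longrightarrow>
                 spectrum \<beta> (cmat A) \<subseteq> {z. Re z < 0} \<and> \<epsilon> \<le> stab_dist \<beta> (cmat A)))))"
    (is "(?i \<longleftrightarrow> (\<exists>h>0. \<forall>\<epsilon>. _ \<and> \<epsilon> < h \<longrightarrow> (\<exists>\<beta>. ?ra \<epsilon> \<beta>) \<and> (\<forall>\<beta>. _ \<longrightarrow> ?good \<epsilon> \<beta>))) \<and> (_ \<longleftrightarrow> ?iii) \<and> (_ \<longrightarrow> (_ \<longleftrightarrow> ?ii'))")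
proof -
  have nonsingular: "det A \<noteq> 0" if ?i
  proof
    assume "det A = 0"
    have "pow_diag 0 \<alpha> = 0" by (simp add: pow_diag_def vec_eq_iff)
    moreover obtain x where "x \<noteq> 0" "cmat A *v x = 0"
      using \<open>det A = 0\<close> det_eq_0_iff_kernel[of "cmat A"] by (auto simp: det_cmat)
    ultimately have "0 \<in> spectrum \<alpha> (cmat A)"
      by (auto simp: spectrum_def det_eq_0_iff_kernel matrix_vector_mult_diff_rdistrib)
    with that show False by auto
  qed
  have ex: "\<exists>\<beta>. ?ra \<epsilon> \<beta>" if "det A \<noteq> 0" "0 < \<epsilon>" for \<epsilon>
    using exists_rational_approx assms that by blast
  have conv: ?i if "?ra \<epsilon> \<beta>" "?good \<epsilon> \<beta>" "0 < \<epsilon>" for \<epsilon> \<beta>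
    using stable_if_approx_stable that by blast
  have transfer: "\<exists>h>0. \<forall>\<epsilon>. 0 < \<epsilon> \<and> \<epsilon> < h \<longrightarrow> (\<forall>\<beta>. ?ra \<epsilon> \<beta> \<longrightarrow> ?good \<epsilon> \<beta>)" if ?i
    using approx_stable_if_stable[OF _ that] assms by metis
  have half: "0 < h / 2 \<and> h / 2 < h" if "0 < h" for h :: real using that by simp
  have conv_all: ?i if h: "0 < h" "\<exists>\<beta>. ?ra (h / 2) \<beta>"
    "\<forall>\<epsilon>. 0 < \<epsilon> \<and> \<epsilon> < h \<longrightarrow> (\<forall>\<beta>. ?ra \<epsilon> \<beta> \<longrightarrow> ?good \<epsilon> \<beta>)" for h
  proof -
    obtain \<beta> where "?ra (h / 2) \<beta>" using h(2) by blast
    moreover from this have "?good (h / 2) \<beta>" using h(3) half[OF h(1)] by blast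
    ultimately show ?i using conv half[OF h(1)] by blast
  qed
  show ?thesis
  proof (intro conjI impI)
    show "?i \<longleftrightarrow> (\<exists>h>0. \<forall>\<epsilon>. 0 < \<epsilon> \<and> \<epsilon> < h \<longrightarrow> (\<exists>\<beta>. ?ra \<epsilon> \<beta>) \<and> (\<forall>\<beta>. ?ra \<epsilon> \<beta> \<longrightarrow> ?good \<epsilon> \<beta>))"
      (is "_ \<longleftrightarrow> ?ii")
    proof
      assume ?i
      then obtain h where "h > 0" "\<forall>\<epsilon>. 0 < \<epsilon> \<and> \<epsilon> < h \<longrightarrow> (\<forall>\<beta>. ?ra \<epsilon> \<beta> \<longrightarrow> ?good \<epsilon> \<beta>)"
        using transfer by blast
      then show ?ii using ex[OF nonsingular[OF \<open>?i\<close>]] by blast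
    next
      assume ?ii
      then obtain h where "h > 0" "\<forall>\<epsilon>. 0 < \<epsilon> \<and> \<epsilon> < h \<longrightarrow>
          (\<exists>\<beta>. ?ra \<epsilon> \<beta>) \<and> (\<forall>\<beta>. ?ra \<epsilon> \<beta> \<longrightarrow> ?good \<epsilon> \<beta>)" by blast
      then show ?i using half[of h] by (intro conv_all[of h]) blast+
    qed
    show "?i \<longleftrightarrow> ?iii"
    proof
      assume ?i
      then obtain h where h: "h > 0" "\<forall>\<epsilon>. 0 < \<epsilon> \<and> \<epsilon> < h \<longrightarrow> (\<forall>\<beta>. ?ra \<epsilon> \<beta> \<longrightarrow> ?good \<epsilon> \<beta>)"
        using transfer by blast
      moreover obtain \<beta> where "?ra (h / 2) \<beta>"
        using ex[OF nonsingular[OF \<open>?i\<close>], of "h / 2"] half[OF h(1)] by blast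
      ultimately show ?iii using half[OF h(1)] by blast
    next
      assume ?iii
      then show ?i using conv by blast
    qed
    assume det: "det A \<noteq> 0"
    show "?i \<longleftrightarrow> ?ii'"
    proof
      assume ?ii'
      then obtain h where h: "h > 0" "\<forall>\<epsilon>. 0 < \<epsilon> \<and> \<epsilon> < h \<longrightarrow> (\<forall>\<beta>. ?ra \<epsilon> \<beta> \<longrightarrow> ?good \<epsilon> \<beta>)"
        by blast
      then show ?i using ex[OF det] half[OF h(1)] by (intro conv_all[of h]) blast+
    qed (rule transfer)
  qed
qed

end
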